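(* Let $n\geq 2$ and let $\{G_m=(V_m,E_m): m\in\{1,\dots,n\}\}$ be a finite collection of connected graphs such that there is a nonempty set $S$ with $V_m\cap V_l=S$ for all distinct $m,l\in\{1,\dots,n\}$. Let $G=\bigcup_{m=1}^n G_m$ and $H=\bigcap_{m=1}^n G_m$ (so $V(H)=S$). Suppose that (1) $H$ is connected, and (2) $H$ is an isometric subgraph of $G_m$ for every $m\in\{1,\dots,n\}$. Then each $G_m$ is an isometric subgraph of $G$, and every vertex $u$ of $H$ satisfies $e_G(u)=\max\{e_{G_m}(u): m\in\{1,\dots,n\}\}$.
   Context: The union of graphs $G,H$ is $(V(G)\cup V(H),E(G)\cup E(H))$ and the intersection is $(V(G)\cap V(H),E(G)\cap E(H))$. A subgraph $K$ of a graph $G$ is isometric if $d_K(u,v)=d_G(u,v)$ for all $u,v\in V(K)$, where $d$ denotes shortest-path distance. The eccentricity of $u$ in $G$ is $e_G(u)=\max_{x\in V(G)} d_G(u,x)$. *)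

theory Defs
  imports Main "HOL-Library.Extended_Nat"
begin

record 'a ugraph =
  gverts :: "'a set"
  gedges :: "'a set set"

text \<open>Simple undirected graphs; the vertex set may be finite or infinite.\<close>

definition is_graph :: "'a ugraph \<Rightarrow> bool" where
  "is_graph G \<longleftrightarrow> (\<forall>e\<in>gedges G. e \<subseteq> gverts G \<and> card e = 2)"

definition is_path :: "'a ugraph \<Rightarrow> 'a \<Rightarrow> 'a list \<Rightarrow> 'a \<Rightarrow> bool" where
  "is_path G u p v \<longleftrightarrow>
     p \<noteq> [] \<and> hd p = u \<and> last p = v \<and> distinct p \<and> set p \<subseteq> gverts G \<and>
     successively (\<lambda>x y. {x, y} \<in> gedges G) p"

definition path_length :: "'a list \<Rightarrow> nat" where
  "path_length p = length p - 1"

definition connected_graph :: "'a ugraph \<Rightarrow> bool" where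
  "connected_graph G \<longleftrightarrow>
     gverts G \<noteq> {} \<and> (\<forall>u\<in>gverts G. \<forall>v\<in>gverts G. \<exists>p. is_path G u p v)"

text \<open>The distance is \<open>\<infinity>\<close> when there is no path, the infimum being over the empty set.\<close>

definition gdist :: "'a ugraph \<Rightarrow> 'a \<Rightarrow> 'a \<Rightarrow> enat" where
  "gdist G u v = (INF p\<in>{p. is_path G u p v}. enat (path_length p))"

text \<open>For finite graphs the supremum is a maximum, see \<open>ecc_eq_Max\<close>. For infinite graphs it is
  \<open>\<infinity>\<close> when the distances from \<open>u\<close> are unbounded.\<close>

definition ecc :: "'a ugraph \<Rightarrow> 'a \<Rightarrow> enat" where
  "ecc G u = (SUP x\<in>gverts G. gdist G u x)"

lemma ecc_eq_Max:
  assumes "finite (gverts G)" and "gverts G \<noteq> {}"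
  shows "ecc G u = Max (gdist G u ` gverts G)"
  unfolding ecc_def using assms by (simp add: Max_Sup)

definition subgraph :: "'a ugraph \<Rightarrow> 'a ugraph \<Rightarrow> bool" where
  "subgraph K G \<longleftrightarrow>
     is_graph K \<and> is_graph G \<and> gverts K \<subseteq> gverts G \<and> gedges K \<subseteq> gedges G"

definition isometric_subgraph :: "'a ugraph \<Rightarrow> 'a ugraph \<Rightarrow> bool" where
  "isometric_subgraph K G \<longleftrightarrow>
     subgraph K G \<and> (\<forall>u\<in>gverts K. \<forall>v\<in>gverts K. gdist K u v = gdist G u v)"

definition graph_Union :: "'i set \<Rightarrow> ('i \<Rightarrow> 'a ugraph) \<Rightarrow> 'a ugraph" where
  "graph_Union I G = \<lparr>gverts = (\<Union>i\<in>I. gverts (G i)), gedges = (\<Union>i\<in>I. gedges (G i))\<rparr>"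

definition graph_Inter :: "'i set \<Rightarrow> ('i \<Rightarrow> 'a ugraph) \<Rightarrow> 'a ugraph" where
  "graph_Inter I G = \<lparr>gverts = (\<Inter>i\<in>I. gverts (G i)), gedges = (\<Inter>i\<in>I. gedges (G i))\<rparr>"

end

theory Submission
  imports Defs
begin

text \<open>Every function that grows by at most one along each edge grows by at most \<open>d(u,v)\<close> from
  \<open>u\<close> to \<open>v\<close>. For \<open>u\<close> in \<open>G\<^sub>m\<close>, extend the distance from \<open>u\<close> in \<open>G\<^sub>m\<close> to the whole union by sending
  a vertex \<open>x\<close> of another \<open>G\<^sub>l\<close> to the infimum of \<open>d\<^sub>m(u,s) + d\<^sub>l(s,x)\<close> over \<open>s \<in> V(H)\<close>. Since \<open>d\<^sub>l\<close> and \<open>d\<^sub>m\<close>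
  agree on \<open>H\<close>, the extension grows by at most one along each edge, which bounds distances in the
  union from below.\<close>

text \<open>Since \<open>enat\<close> is well-ordered, only the empty set can miss its infimum, and
  that infimum is \<infinity>.\<close>

lemma Inf_enat_attained: "Inf (A :: enat set) \<noteq> \<infinity> \<Longrightarrow> Inf A \<in> A"
  unfolding Inf_enat_def by (auto intro: LeastI split: if_splits)

lemma gdist_cases:
  obtains (infinite) "gdist G u v = \<infinity>"
  | (path) p where "is_path G u p v" "gdist G u v = enat (path_length p)"
proof (cases "gdist G u v = \<infinity>")
  case False
  then have "gdist G u v \<in> (\<lambda>p. enat (path_length p)) ` {p. is_path G u p v}"
    unfolding gdist_def by (rule Inf_enat_attained)
  then show ?thesis using path by blast
qed

lemma gdist_le_path_length: "is_path G u p v \<Longrightarrow> gdist G u v \<le> enat (path_length p)"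
  unfolding gdist_def by (rule INF_lower) simp

lemma gdist_refl:
  assumes "u \<in> gverts G"
  shows "gdist G u u = 0"
proof -
  have "is_path G u [u] u" using assms by (simp add: is_path_def)
  from gdist_le_path_length[OF this] show ?thesis
    by (simp add: path_length_def zero_enat_def[symmetric])
qed

text \<open>Take a shortest path to \<open>x\<close>. Paths have distinct vertices, so
  \<open>y\<close> can be appended only if it is not yet on the path; otherwise the path is cut off
  at \<open>y\<close>, which only shortens it.\<close>

lemma gdist_le_gdist_add_1:
  assumes "is_graph G" and e: "{x, y} \<in> gedges G"
  shows "gdist G u y \<le> gdist G u x + 1"
proof (cases G u x rule: gdist_cases)
  case infinite
  then show ?thesis by simp
next
  case (path p)
  note p = path(1) and d = path(2)
  show ?thesis
  proof (cases "y \<in> set p")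
    case True
    then obtain as bs where ab: "p = as @ y # bs" by (auto simp: in_set_conv_decomp)
    have "successively (\<lambda>x y. {x, y} \<in> gedges G) ((as @ [y]) @ bs)"
      using p by (simp add: is_path_def ab)
    then have "successively (\<lambda>x y. {x, y} \<in> gedges G) (as @ [y])"
      by (subst (asm) successively_append_iff) blast
    then have "is_path G u (as @ [y]) y"
      using p by (cases as) (auto simp: is_path_def ab)
    from gdist_le_path_length[OF this] have "gdist G u y \<le> enat (length as)"
      by (simp add: path_length_def)
    also have "\<dots> \<le> gdist G u x + 1"
      by (simp add: d path_length_def ab one_enat_def)
    finally show ?thesis .
  next
    case False
    have "y \<in> gverts G" using assms by (auto simp: is_graph_def)
    with False p e have "is_path G u (p @ [y]) y"
      by (auto simp: is_path_def successively_append_iff)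
    moreover have "p \<noteq> []" using p by (simp add: is_path_def)
    ultimately show ?thesis
      using gdist_le_path_length[of G u "p @ [y]" y] by (simp add: d path_length_def one_enat_def)
  qed
qed

lemma gdist_edge_le_1:
  assumes "is_graph G" and "{x, y} \<in> gedges G"
  shows "gdist G x y \<le> 1"
proof -
  have "x \<in> gverts G" using assms by (auto simp: is_graph_def)
  then show ?thesis using gdist_le_gdist_add_1[OF assms, of x] by (simp add: gdist_refl)
qed

lemma le_add_gdist:
  fixes f :: "'a \<Rightarrow> enat"
  assumes f: "\<And>x y. {x, y} \<in> gedges G \<Longrightarrow> f y \<le> f x + 1"
  shows "f v \<le> f u + gdist G u v"
proof (cases G u v rule: gdist_cases)
  case infinite
  then show ?thesis by simp
next
  case (path p)
  note p = path(1) and d = path(2)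
  \<comment> \<open>The claim covers walks with repeated vertices and names the ends by
    \<open>hd\<close> and \<open>last\<close>, which lets the induction drop the first
    vertex.\<close>
  have "f (last p) \<le> f (hd p) + enat (length p - 1)"
    if "p \<noteq> []" "successively (\<lambda>x y. {x, y} \<in> gedges G) p" for p
    using that
  proof (induction p rule: induct_list012)
    case (3 x y zs)
    then have "f (last (y # zs)) \<le> f y + enat (length zs)" by simp
    also have "\<dots> \<le> f x + 1 + enat (length zs)"
      using 3 by (intro add_right_mono f) simp
    also have "\<dots> = f x + enat (Suc (length zs))"
      by (simp add: add.assoc one_enat_def)
    finally show ?case by simp
  qed (auto simp: zero_enat_def[symmetric])
  from this[of p] p show ?thesis by (auto simp: is_path_def d path_length_def)
qed

text \<open>The function that grows by at most one along each edge is here the distance from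
  \<open>u\<close>.\<close>

lemma gdist_triangle:
  assumes "is_graph G"
  shows "gdist G u w \<le> gdist G u v + gdist G v w"
  by (rule le_add_gdist) (rule gdist_le_gdist_add_1[OF assms])

lemma gdist_antimono:
  assumes "subgraph K G"
  shows "gdist G u v \<le> gdist K u v"
  unfolding gdist_def
proof (rule INF_superset_mono)
  show "{p. is_path K u p v} \<subseteq> {p. is_path G u p v}"
    using assms by (auto simp: is_path_def subgraph_def elim: successively_mono)
qed simp

lemma is_graph_Union: "(\<And>i. i \<in> I \<Longrightarrow> is_graph (G i)) \<Longrightarrow> is_graph (graph_Union I G)"
  unfolding is_graph_def graph_Union_def by fastforce

lemma isometric_subgraph_graph_Union:
  fixes I :: "'i set" and G :: "'i \<Rightarrow> 'a ugraph"
  defines "H \<equiv> graph_Inter I G"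
  assumes gr: "\<And>i. i \<in> I \<Longrightarrow> is_graph (G i)"
    and int: "\<And>i j. i \<in> I \<Longrightarrow> j \<in> I \<Longrightarrow> i \<noteq> j \<Longrightarrow> gverts (G i) \<inter> gverts (G j) \<subseteq> gverts H"
    and iso: "\<And>i. i \<in> I \<Longrightarrow> isometric_subgraph H (G i)"
    and m: "m \<in> I"
  shows "isometric_subgraph (G m) (graph_Union I G)"
proof -
  have sub: "subgraph (G m) (graph_Union I G)"
    using m gr is_graph_Union[of I G] by (auto simp: subgraph_def graph_Union_def)
  \<comment> \<open>Both sides equal the distance in \<open>H\<close>.\<close>
  have agree: "gdist (G i) s t = gdist (G m) s t"
    if "i \<in> I" "s \<in> gverts H" "t \<in> gverts H" for i s t
    using iso[OF that(1)] iso[OF m] that by (simp add: isometric_subgraph_def)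
  have HV: "gverts H \<subseteq> gverts (G i)" if "i \<in> I" for i
    using that by (auto simp: H_def graph_Inter_def)
  have "gdist (G m) u v \<le> gdist (graph_Union I G) u v"
    if u: "u \<in> gverts (G m)" and v: "v \<in> gverts (G m)" for u v
  proof -
    \<comment> \<open>\<open>l\<close> is a graph containing \<open>x\<close>, and \<open>s\<close>
      is where a path from \<open>u\<close> may pass into it. If there is no such pair, the infimum
      below is \<infinity>.\<close>
    define A where "A x = {(l, s). l \<in> I \<and> s \<in> gverts H \<and> x \<in> gverts (G l)}" for x
    define f where "f x = (if x \<in> gverts (G m) then gdist (G m) u x
      else INF (l, s)\<in>A x. gdist (G m) u s + gdist (G l) s x)" for x
    have f_le: "f x \<le> gdist (G m) u s + gdist (G l) s x"
      if l: "l \<in> I" and s: "s \<in> gverts H" and x: "x \<in> gverts (G l)" for l s x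
    proof (cases "x \<in> gverts (G m)")
      case False
      then show ?thesis using that unfolding f_def A_def
        by (auto intro!: INF_lower2[where i = "(l, s)"])
    next
      \<comment> \<open>Isometry enters here: for \<open>l\<close> other than \<open>m\<close>,
        \<open>x\<close> lies in \<open>H\<close>, so the distance from \<open>s\<close> to
        \<open>x\<close> is the same in \<open>G l\<close> and \<open>G m\<close>, and the triangle
        inequality in \<open>G m\<close> finishes.\<close>
      case True
      have "gdist (G l) s x = gdist (G m) s x"
      proof (cases "l = m")
        case False
        then show ?thesis using int[OF l m] True x s agree[OF l] by blast
      qed simp
      then show ?thesis using True gdist_triangle[OF gr[OF m]] by (simp add: f_def)
    qed
    have "f y \<le> f x + 1" if "{x, y} \<in> gedges (graph_Union I G)" for x y
    proof -
      from that obtain l where l: "l \<in> I" and e: "{x, y} \<in> gedges (G l)"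
        by (auto simp: graph_Union_def)
      have xy: "x \<in> gverts (G l)" "y \<in> gverts (G l)"
        using gr[OF l] e by (auto simp: is_graph_def)
      show ?thesis
      proof (cases "x \<in> gverts (G m)")
        case True
        show ?thesis
        proof (cases "l = m")
          case True
          then show ?thesis
            using xy e gdist_le_gdist_add_1[OF gr[OF m]] by (simp add: f_def)
        next
          case False
          \<comment> \<open>The edge leaves \<open>G m\<close> through \<open>H\<close>, so
            \<open>x\<close> itself can serve as \<open>s\<close> in \<open>f_le\<close>.\<close>
          then have "x \<in> gverts H" using int[OF l m] xy True by blast
          then have "f y \<le> gdist (G m) u x + gdist (G l) x y" using f_le l xy by blast
          also have "\<dots> \<le> gdist (G m) u x + 1"
            by (intro add_left_mono gdist_edge_le_1[OF gr[OF l] e])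
          finally show ?thesis using True by (simp add: f_def)
        qed
      next
        case False
        show ?thesis
        proof (cases "f x = \<infinity>")
          case fin: False
          then have "f x \<in> (\<lambda>(l, s). gdist (G m) u s + gdist (G l) s x) ` A x"
            using False Inf_enat_attained by (auto simp: f_def)
          then obtain i s where i: "i \<in> I" and s: "s \<in> gverts H" and xi: "x \<in> gverts (G i)"
            and fx: "f x = gdist (G m) u s + gdist (G i) s x"
            by (auto simp: A_def)
          \<comment> \<open>A vertex outside \<open>G m\<close> is outside \<open>H\<close>, so it
            lies in only one of the graphs. The \<open>s\<close> attaining \<open>f x\<close> then
            also bounds \<open>f y\<close>, wherever \<open>y\<close> lies.\<close>
          have "i = l" using int[OF i l] xi xy False HV[OF m] by blast
          have "f y \<le> gdist (G m) u s + gdist (G l) s y" using f_le l s xy by blast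
          also have "\<dots> \<le> gdist (G m) u s + (gdist (G l) s x + 1)"
            by (intro add_left_mono gdist_le_gdist_add_1[OF gr[OF l] e])
          finally show ?thesis using fx \<open>i = l\<close> by (simp add: add.assoc)
        qed simp
      qed
    qed
    \<comment> \<open>On \<open>G m\<close>, \<open>f\<close> is the distance from \<open>u\<close>
      in \<open>G m\<close>; in particular \<open>f u = 0\<close>.\<close>
    from le_add_gdist[of "graph_Union I G" f, OF this]
    have "f v \<le> f u + gdist (graph_Union I G) u v" by blast
    then show ?thesis using u v by (simp add: f_def gdist_refl)
  qed
  then show ?thesis
    using sub gdist_antimono[OF sub] by (auto simp: isometric_subgraph_def intro: antisym)
qed

text \<open>A supremum over a union is an iterated supremum, and since \<open>u\<close> lies in
  every \<open>G i\<close>, isometry turns each inner one into an eccentricity in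
  \<open>G i\<close>.\<close>

lemma ecc_graph_Union:
  assumes "\<And>i. i \<in> I \<Longrightarrow> isometric_subgraph (G i) (graph_Union I G)"
    and "\<And>i. i \<in> I \<Longrightarrow> u \<in> gverts (G i)"
  shows "ecc (graph_Union I G) u = (SUP i\<in>I. ecc (G i) u)"
proof -
  have "ecc (graph_Union I G) u = (SUP i\<in>I. SUP x\<in>gverts (G i). gdist (graph_Union I G) u x)"
    unfolding ecc_def by (simp add: graph_Union_def SUP_UNION)
  also have "\<dots> = (SUP i\<in>I. ecc (G i) u)"
    unfolding ecc_def
    using assms by (intro SUP_cong refl) (simp add: isometric_subgraph_def)
  finally show ?thesis .
qed

theorem theorem21:
  fixes n :: nat and G :: "nat \<Rightarrow> 'a ugraph" and S :: "'a set"
  assumes "n \<ge> 2"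
    and "\<forall>m\<in>{1..n}. is_graph (G m) \<and> connected_graph (G m)"
    and "S \<noteq> {}"
    and "\<forall>m\<in>{1..n}. \<forall>l\<in>{1..n}. m \<noteq> l \<longrightarrow> gverts (G m) \<inter> gverts (G l) = S"
    and "connected_graph (graph_Inter {1..n} G)"
    and "\<forall>m\<in>{1..n}. isometric_subgraph (graph_Inter {1..n} G) (G m)"
  shows "(\<forall>m\<in>{1..n}. isometric_subgraph (G m) (graph_Union {1..n} G)) \<and>
         (\<forall>u\<in>gverts (graph_Inter {1..n} G).
            ecc (graph_Union {1..n} G) u = Max {ecc (G m) u | m. m \<in> {1..n}})"
proof -
  let ?I = "{1..n}"
  have "S \<subseteq> gverts (graph_Inter ?I G)"
  proof
    fix x assume x: "x \<in> S"
    have "x \<in> gverts (G i)" if i: "i \<in> ?I" for i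
    proof -
      \<comment> \<open>A second index \<open>j\<close> is needed to write \<open>S\<close> as an
        intersection of \<open>G i\<close> with another graph: 2 if \<open>i\<close> is 1, and 1
        otherwise.\<close>
      obtain j where "j \<in> ?I" "i \<noteq> j"
        using \<open>n \<ge> 2\<close> that by (cases "i = 1") (auto intro: that[of 1] that[of 2])
      then show ?thesis using assms(4) i x by blast
    qed
    then show "x \<in> gverts (graph_Inter ?I G)" by (simp add: graph_Inter_def)
  qed
  then have iso: "isometric_subgraph (G m) (graph_Union ?I G)" if "m \<in> ?I" for m
    using assms(2,4,6) that by (intro isometric_subgraph_graph_Union) blast+
  moreover have "ecc (graph_Union ?I G) u = Max {ecc (G m) u | m. m \<in> ?I}"
    if "u \<in> gverts (graph_Inter ?I G)" for u
  proof -
    have "ecc (graph_Union ?I G) u = (SUP m\<in>?I. ecc (G m) u)"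
      using that by (intro ecc_graph_Union iso) (auto simp: graph_Inter_def)
    \<comment> \<open>The index set is finite and nonempty, so the maximum exists even if some
      eccentricities are \<infinity>.\<close>
    also have "\<dots> = Max ((\<lambda>m. ecc (G m) u) ` ?I)"
      using \<open>n \<ge> 2\<close> by (intro Max_Sup[symmetric]) auto
    also have "(\<lambda>m. ecc (G m) u) ` ?I = {ecc (G m) u | m. m \<in> ?I}" by blast
    finally show ?thesis .
  qed
  ultimately show ?thesis by blast
qed

end
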